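(* Let $n\ge 2$. (1) Let $G\subsetneq\mathbb{R}^n$ be a domain. For each $x\in G$ and $r\in(0,1)$, $$B^n\left(x,\frac{2r}{1+r}d_G(x)\right)\subset B_s(x,r)\subset B^n\left(x,\frac{2r}{1-r}d_G(x)\right).$$ (2) Let $G\subsetneq\mathbb{R}^n$ be a domain. For each $x\in G$ and $r\in(0,1)$, $$B_j(x,\log(1+2r))\subset B_s(x,r),$$ and this inclusion is sharp if there exists a point $w\in\partial B_s(x,r)$ such that $d_G(x)=d_G(w)$ and $$\partial G\cap S^{n-1}(w,d_G(w))\cap S^{n-1}(x,d_G(x))\ne\emptyset.$$ Moreover, for each $x\in G$ and $r\in(0,\tfrac13)$, $$B_s(x,r)\subset B_j\left(x,\log\left(1+\frac{2r}{1-3r}\right)\right).$$ (3) Let $G=\mathbb{R}^n\setminus\{0\}$. For each $x\in G$ and $r\in(0,1)$, $$B^n\left(x,\frac{2r}{1+r}|x|\right)\subset B_s(x,r)\subset B^n\left(x,\frac{2r}{1-r}|x|\right).$$ Moreover, the inclusions are sharp. (4) Let $G=\mathbb{R}^n\setminus\{0\}$. For each $x\in G$ and $r\in(0,1)$, $$B_j(x,m)\subset B_s(x,r)\subset B_j(x,M),$$ where $m=\log(1+2r)$ and $M=\log\left(1+\frac{2r}{1-r}\right)$. Moreover, the inclusions are sharp.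
   Context: For a domain (nonempty open connected set) $G\subsetneq\mathbb{R}^n$ and $x,y\in G$, put $d_G(x)=d(x,\partial G)$ (Euclidean distance to the boundary), and define the triangular ratio metric $$s_G(x,y)=\sup_{z\in\partial G}\frac{|x-y|}{|z-x|+|z-y|}$$ and the $j$-metric $$j_G(x,y)=\log\left(1+\frac{|x-y|}{\min\{d_G(x),d_G(y)\}}\right).$$ For $x\in G$ and $r>0$, $B_s(x,r)=\{y\in G:s_G(x,y)<r\}$ and $B_j(x,r)=\{y\in G:j_G(x,y)<r\}$. $B^n(a,\varrho)$ and $S^{n-1}(a,\varrho)$ are the open Euclidean ball and the Euclidean sphere in $\mathbb{R}^n$ with center $a$ and radius $\varrho$. An inclusion between balls with the same center $x$ is called sharp if, for the given $x$ and $r$, the radius of the comparison (Euclidean or $j$-) ball cannot be improved: when that ball is the inner one its radius cannot be replaced by any larger number, and when it is the outer one its radius cannot be replaced by any smaller number. *)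

theory Defs
  imports "HOL-Analysis.Analysis"
begin

definition is_domain :: "'a::topological_space set \<Rightarrow> bool" where
  "is_domain G \<longleftrightarrow> G \<noteq> {} \<and> open G \<and> connected G"

definition bdist :: "'a::euclidean_space set \<Rightarrow> 'a \<Rightarrow> real" where
  "bdist G x = infdist x (frontier G)"

text \<open>For a domain \<open>G \<noteq> UNIV\<close> and \<open>x, y \<in> G\<close> the supremum below is a genuine one: the boundary
  is nonempty, the denominators are positive, and the quotients are bounded above by \<open>1\<close>.\<close>

definition triangular_ratio :: "'a::euclidean_space set \<Rightarrow> 'a \<Rightarrow> 'a \<Rightarrow> real" where
  "triangular_ratio G x y = (SUP z\<in>frontier G. norm (x - y) / (norm (z - x) + norm (z - y)))"

definition j_metric :: "'a::euclidean_space set \<Rightarrow> 'a \<Rightarrow> 'a \<Rightarrow> real" where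
  "j_metric G x y = ln (1 + norm (x - y) / min (bdist G x) (bdist G y))"

definition s_ball :: "'a::euclidean_space set \<Rightarrow> 'a \<Rightarrow> real \<Rightarrow> 'a set" where
  "s_ball G x r = {y \<in> G. triangular_ratio G x y < r}"

definition j_ball :: "'a::euclidean_space set \<Rightarrow> 'a \<Rightarrow> real \<Rightarrow> 'a set" where
  "j_ball G x r = {y \<in> G. j_metric G x y < r}"

text \<open>Sharpness of an inclusion \<open>B \<rho> \<subseteq> A\<close> (respectively \<open>A \<subseteq> B \<rho>\<close>), where \<open>B\<close> maps a radius to
  the comparison ball of that radius with the fixed centre. The inclusion itself is not part of
  these predicates.\<close>

definition sharp_inner_radius :: "(real \<Rightarrow> 'a set) \<Rightarrow> real \<Rightarrow> 'a set \<Rightarrow> bool" where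
  "sharp_inner_radius B \<rho> A \<longleftrightarrow> (\<forall>\<rho>'>\<rho>. \<not> B \<rho>' \<subseteq> A)"

definition sharp_outer_radius :: "(real \<Rightarrow> 'a set) \<Rightarrow> real \<Rightarrow> 'a set \<Rightarrow> bool" where
  "sharp_outer_radius B \<rho> A \<longleftrightarrow> (\<forall>\<rho>'<\<rho>. \<not> A \<subseteq> B \<rho>')"

end

theory Submission
  imports Defs
begin

text \<open>Write \<open>t = norm (x - y)\<close>. Every boundary point \<open>z\<close> is at distance at least \<open>bdist G x\<close>
  from \<open>x\<close> and at least \<open>max (bdist G y) (bdist G x - t)\<close> from \<open>y\<close>, which bounds \<open>s\<close> from above by
  \<open>t / (bdist G x + bdist G y)\<close> and \<open>t / (2 * bdist G x - t)\<close>. Evaluating the supremum at a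
  boundary point nearest to \<open>x\<close> gives \<open>t / (2 * bdist G x + t) \<le> s\<close>; by symmetry this also holds
  with \<open>bdist G y\<close>, so \<open>s < r\<close> implies \<open>t < 2 * r / (1 - r) * min (bdist G x) (bdist G y)\<close>, and this
  covers both outer inclusions into \<open>j\<close>-balls. In the punctured space \<open>s\<close> is
  \<open>norm (x - y) / (norm x + norm y)\<close>; sharpness is witnessed by points on the ray through \<open>x\<close>
  and, for the inner \<open>j\<close>-ball, by points of the sphere through \<open>x\<close>.\<close>

section \<open>Distance to the boundary of a domain\<close>

lemma frontier_domain_nonempty:
  fixes G :: "'a::euclidean_space set"
  assumes "is_domain G" "G \<noteq> UNIV"
  shows "frontier G \<noteq> {}"
  using assms frontier_eq_empty unfolding is_domain_def by blast

lemma bdist_le: "z \<in> frontier G \<Longrightarrow> bdist G x \<le> norm (z - x)"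
  unfolding bdist_def by (metis infdist_le dist_commute dist_norm)

lemma bdist_attained:
  assumes "frontier G \<noteq> {}"
  obtains z where "z \<in> frontier G" "norm (z - x) = bdist G x"
  using infdist_attains_inf[OF frontier_closed assms] unfolding bdist_def
  by (metis dist_commute dist_norm)

lemma bdist_pos:
  assumes "is_domain G" "G \<noteq> UNIV" "x \<in> G"
  shows "0 < bdist G x"
proof -
  obtain z where z: "z \<in> frontier G" "norm (z - x) = bdist G x"
    using bdist_attained frontier_domain_nonempty assms by metis
  moreover have "x \<notin> frontier G"
    using assms by (simp add: frontier_def is_domain_def interior_open)
  ultimately show ?thesis by (metis eq_iff_diff_eq_0 zero_less_norm_iff)
qed

text \<open>A ball is connected, so if it met both \<open>G\<close> and its complement it would
  contain a boundary point, closer to \<open>x\<close> than \<open>bdist G x\<close> allows.\<close>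

lemma ball_bdist_subset:
  assumes "x \<in> G"
  shows "ball x (bdist G x) \<subseteq> G"
proof (rule ccontr)
  assume a: "\<not> ball x (bdist G x) \<subseteq> G"
  then have "ball x (bdist G x) \<inter> G \<noteq> {}"
    using assms by (metis IntI ball_eq_empty centre_in_ball empty_iff empty_subsetI not_le)
  then obtain z where "z \<in> ball x (bdist G x)" "z \<in> frontier G"
    using a connected_Int_frontier[OF connected_ball] by (metis Diff_eq_empty_iff disjoint_iff)
  then show False using bdist_le[of z G x] by (simp add: dist_norm norm_minus_commute)
qed

section \<open>Estimates for the triangular ratio metric\<close>

lemma triangular_ratio_term_le_one:
  fixes x y z :: "'a::real_normed_vector"
  shows "norm (x - y) / (norm (z - x) + norm (z - y)) \<le> 1"
proof -
  have "norm (x - y) \<le> norm (z - x) + norm (z - y)"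
    by (metis dist_norm dist_triangle2 dist_commute)
  then show ?thesis by (simp add: divide_le_eq_1) (smt (verit) norm_ge_zero)
qed

text \<open>The uniform bound \<open>1\<close> on the quotients makes them bounded above, so each of
  them lies below the supremum.\<close>

lemma triangular_ratio_ge:
  assumes "z \<in> frontier G"
  shows "norm (x - y) / (norm (z - x) + norm (z - y)) \<le> triangular_ratio G x y"
  unfolding triangular_ratio_def
  by (rule cSUP_upper[OF assms]) (meson bdd_aboveI2 triangular_ratio_term_le_one)

lemma triangular_ratio_le:
  assumes "frontier G \<noteq> {}" "0 < c" "\<And>z. z \<in> frontier G \<Longrightarrow> c \<le> norm (z - x) + norm (z - y)"
  shows "triangular_ratio G x y \<le> norm (x - y) / c"
  unfolding triangular_ratio_def
proof (rule cSUP_least[OF assms(1)])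
  fix z assume "z \<in> frontier G"
  then show "norm (x - y) / (norm (z - x) + norm (z - y)) \<le> norm (x - y) / c"
    using assms by (intro divide_left_mono mult_pos_pos) force+
qed

lemma triangular_ratio_commute: "triangular_ratio G x y = triangular_ratio G y x"
  unfolding triangular_ratio_def by (simp add: norm_minus_commute add.commute)

lemma norm_less_if_triangular_ratio_less:
  assumes "frontier G \<noteq> {}" "0 < bdist G x" "r \<in> {0<..<1}" "triangular_ratio G x y < r"
  shows "norm (x - y) < 2 * r / (1 - r) * bdist G x"
proof -
  obtain z where z: "z \<in> frontier G" "norm (z - x) = bdist G x"
    using bdist_attained assms by metis
  have "norm (x - y) / (bdist G x + norm (z - y)) < r"
    using triangular_ratio_ge[OF z(1), of x y] assms(4) z(2) by simp
  then have "norm (x - y) < r * (bdist G x + norm (z - y))"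
    using assms(2) by (simp add: divide_less_eq add_pos_nonneg split: if_splits)
  \<comment> \<open>Only \<open>bdist G x\<close> and \<open>norm (x - y)\<close> remain after this;
    the resulting linear inequality is solved for \<open>norm (x - y)\<close> since
    \<open>1 - r\<close> is positive.\<close>
  also have "norm (z - y) \<le> bdist G x + norm (x - y)"
    using z(2) norm_triangle_ineq[of "z - x" "x - y"] by simp
  finally have "norm (x - y) < r * (bdist G x + (bdist G x + norm (x - y)))"
    using assms(3) by simp
  then show ?thesis using assms(3) by (simp add: field_simps)
qed

section \<open>Inclusions between balls in a general domain\<close>

lemma ball_subset_s_ball:
  assumes "is_domain G" "G \<noteq> UNIV" "x \<in> G" "r \<in> {0<..<1}"
  shows "ball x (2 * r / (1 + r) * bdist G x) \<subseteq> s_ball G x r"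
proof
  fix y assume "y \<in> ball x (2 * r / (1 + r) * bdist G x)"
  then have t: "norm (x - y) < 2 * r / (1 + r) * bdist G x" by (simp add: dist_norm)
  have d: "0 < bdist G x" using bdist_pos assms by blast
  \<comment> \<open>Since \<open>r < 1\<close>, the radius is below \<open>bdist G x\<close>: this
    puts \<open>y\<close> in \<open>G\<close> and makes the denominator
    \<open>2 * bdist G x - norm (x - y)\<close> positive.\<close>
  have "2 * r / (1 + r) * bdist G x \<le> 1 * bdist G x"
    using assms(4) d by (intro mult_right_mono) auto
  then have td: "norm (x - y) < bdist G x" using t by simp
  then have "y \<in> G" using ball_bdist_subset[OF assms(3)] by (auto simp: dist_norm)
  moreover have "triangular_ratio G x y \<le> norm (x - y) / (2 * bdist G x - norm (x - y))"
  proof (rule triangular_ratio_le)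
    show "frontier G \<noteq> {}" using frontier_domain_nonempty assms by blast
    show "0 < 2 * bdist G x - norm (x - y)" using td d by simp
    fix z assume "z \<in> frontier G"
    then show "2 * bdist G x - norm (x - y) \<le> norm (z - x) + norm (z - y)"
      using bdist_le[of z G x] norm_triangle_ineq[of "z - y" "y - x"]
      by (simp add: norm_minus_commute)
  qed
  moreover have "norm (x - y) / (2 * bdist G x - norm (x - y)) < r"
    using t td d assms(4) by (simp add: field_simps)
  ultimately show "y \<in> s_ball G x r" unfolding s_ball_def by auto
qed

lemma s_ball_subset_ball:
  assumes "is_domain G" "G \<noteq> UNIV" "x \<in> G" "r \<in> {0<..<1}"
  shows "s_ball G x r \<subseteq> ball x (2 * r / (1 - r) * bdist G x)"
  using norm_less_if_triangular_ratio_less[OF frontier_domain_nonempty[OF assms(1,2)]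
      bdist_pos[OF assms(1-3)] assms(4)]
  by (auto simp: s_ball_def dist_norm)

text \<open>Removes the logarithm and the quotient, so that the inclusions involving
  \<open>j\<close>-balls become linear inequalities between distances.\<close>

lemma mem_j_ball_iff:
  assumes "is_domain G" "G \<noteq> UNIV" "x \<in> G" "0 < 1 + c"
  shows "y \<in> j_ball G x (ln (1 + c)) \<longleftrightarrow> y \<in> G \<and> norm (x - y) < c * min (bdist G x) (bdist G y)"
proof (cases "y \<in> G")
  case True
  then have m: "0 < min (bdist G x) (bdist G y)" using bdist_pos assms by (metis min_less_iff_conj)
  then have "0 < 1 + norm (x - y) / min (bdist G x) (bdist G y)"
    by (simp add: add_pos_nonneg)
  then show ?thesis using True m assms(4)
    unfolding j_ball_def j_metric_def by (simp add: pos_divide_less_eq del: min_less_iff_conj)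
qed (simp add: j_ball_def)

lemma j_ball_subset_s_ball:
  assumes "is_domain G" "G \<noteq> UNIV" "x \<in> G" "0 < r"
  shows "j_ball G x (ln (1 + 2 * r)) \<subseteq> s_ball G x r"
proof
  fix y assume "y \<in> j_ball G x (ln (1 + 2 * r))"
  then have y: "y \<in> G" "norm (x - y) < 2 * r * min (bdist G x) (bdist G y)"
    using mem_j_ball_iff[of G x "2 * r"] assms by auto
  have d: "0 < bdist G x" "0 < bdist G y" using bdist_pos assms y by blast+
  have "triangular_ratio G x y \<le> norm (x - y) / (bdist G x + bdist G y)"
    using frontier_domain_nonempty[OF assms(1,2)] d
    by (intro triangular_ratio_le add_mono bdist_le) auto
  \<comment> \<open>Twice the minimum of the two boundary distances is at most their sum.\<close>
  moreover have "2 * r * min (bdist G x) (bdist G y) \<le> r * (bdist G x + bdist G y)"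
    using assms(4) by (simp add: min_def)
  then have "norm (x - y) / (bdist G x + bdist G y) < r"
    using y(2) d by (simp add: pos_divide_less_eq)
  ultimately show "y \<in> s_ball G x r" unfolding s_ball_def using y by auto
qed

text \<open>The parameter \<open>c\<close> lets one proof serve both \<open>2 * r / (1 - r)\<close>
  and the larger \<open>2 * r / (1 - 3 * r)\<close>.\<close>

lemma s_ball_subset_j_ball:
  assumes "is_domain G" "G \<noteq> UNIV" "x \<in> G" "r \<in> {0<..<1}" "2 * r / (1 - r) \<le> c"
  shows "s_ball G x r \<subseteq> j_ball G x (ln (1 + c))"
proof
  fix y assume "y \<in> s_ball G x r"
  then have y: "y \<in> G" "triangular_ratio G x y < r" by (auto simp: s_ball_def)
  have d: "0 < bdist G x" "0 < bdist G y" using bdist_pos assms y by blast+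
  note F = frontier_domain_nonempty[OF assms(1,2)]
  have "norm (x - y) < 2 * r / (1 - r) * bdist G x"
    by (rule norm_less_if_triangular_ratio_less[OF F d(1) assms(4) y(2)])
  \<comment> \<open>The same estimate with the roles of \<open>x\<close> and \<open>y\<close>
    exchanged, which brings in the minimum of both boundary distances.\<close>
  moreover have "norm (x - y) < 2 * r / (1 - r) * bdist G y"
    using norm_less_if_triangular_ratio_less[OF F d(2) assms(4), of x] y(2)
    by (simp add: triangular_ratio_commute norm_minus_commute)
  ultimately have "norm (x - y) < 2 * r / (1 - r) * min (bdist G x) (bdist G y)"
    by (simp add: min_def)
  also have "\<dots> \<le> c * min (bdist G x) (bdist G y)"
    using assms(5) d by (intro mult_right_mono) auto
  finally have "norm (x - y) < c * min (bdist G x) (bdist G y)" .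
  moreover have "0 \<le> 2 * r / (1 - r)" using assms(4) by simp
  then have "0 < 1 + c" using assms(5) by linarith
  ultimately show "y \<in> j_ball G x (ln (1 + c))"
    using mem_j_ball_iff assms(1-3) y(1) by blast
qed

section \<open>Sharpness of the inner \<open>j\<close>-ball in a general domain\<close>

lemma open_j_ball:
  assumes "is_domain G" "G \<noteq> UNIV" "x \<in> G" "0 < 1 + c"
  shows "open (j_ball G x (ln (1 + c)))"
proof -
  have "j_ball G x (ln (1 + c)) = G \<inter> {y. norm (x - y) < c * min (bdist G x) (bdist G y)}"
    using mem_j_ball_iff[OF assms] by blast
  moreover have "open {y. norm (x - y) < c * min (bdist G x) (bdist G y)}"
    unfolding bdist_def by (intro open_Collect_less continuous_intros)
  ultimately show ?thesis using assms(1) by (simp add: is_domain_def open_Int)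
qed

text \<open>The point \<open>w\<close> has \<open>j\<close>-distance at most
  \<open>ln (1 + 2 * r)\<close> from \<open>x\<close>, so every larger \<open>j\<close>-ball
  contains it while the \<open>s\<close>-ball does not.\<close>

lemma sharp_inner_j_ballI:
  assumes "is_domain G" "G \<noteq> UNIV" "x \<in> G" "w \<in> G" "w \<notin> s_ball G x r"
    "0 < r" "bdist G w = bdist G x" "norm (x - w) \<le> 2 * r * bdist G x"
  shows "sharp_inner_radius (j_ball G x) (ln (1 + 2 * r)) (s_ball G x r)"
  unfolding sharp_inner_radius_def
proof (intro allI impI)
  fix \<rho> assume "ln (1 + 2 * r) < \<rho>"
  moreover have "j_metric G x w \<le> ln (1 + 2 * r)"
    using assms(6-8) bdist_pos[OF assms(1-3)] unfolding j_metric_def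
    by (simp add: pos_divide_le_eq add_pos_nonneg)
  ultimately have "w \<in> j_ball G x \<rho>" using assms(4) by (simp add: j_ball_def)
  then show "\<not> j_ball G x \<rho> \<subseteq> s_ball G x r" using assms(5) by blast
qed

text \<open>Two opposite bounds force \<open>norm (x - w) = 2 * r * bdist G x\<close>. The quotient
  at the common point \<open>z\<close> is then exactly \<open>r\<close>, so \<open>w\<close> is
  outside the \<open>s\<close>-ball and witnesses sharpness.\<close>

lemma sharp_inner_j_ball_if_frontier:
  assumes "is_domain G" "G \<noteq> UNIV" "x \<in> G" "0 < r"
    and w: "w \<in> frontier (s_ball G x r)" "bdist G x = bdist G w"
    and z: "z \<in> frontier G" "z \<in> sphere w (bdist G w)" "z \<in> sphere x (bdist G x)"
  shows "sharp_inner_radius (j_ball G x) (ln (1 + 2 * r)) (s_ball G x r)"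
proof -
  have d: "0 < bdist G x" using bdist_pos assms by blast
  have zw: "norm (z - w) = bdist G x" "norm (z - x) = bdist G x"
    using z w(2) by (simp_all add: dist_norm norm_minus_commute)
  have cl: "w \<in> closure (s_ball G x r)" using w(1) by (simp add: frontier_def)
  have "w \<in> closure G" using cl closure_mono[of "s_ball G x r" G] by (auto simp: s_ball_def)
  \<comment> \<open>A boundary point would have \<open>bdist\<close> zero, but \<open>w\<close>
    shares the positive value at \<open>x\<close>.\<close>
  moreover have "w \<notin> frontier G"
    using bdist_le[of w G w] w(2) d by auto
  ultimately have wG: "w \<in> G" using interior_subset by (auto simp: frontier_def)
  \<comment> \<open>Upper bound: keeping only the quotient at \<open>z\<close>, cleared of its
    denominator, gives a closed condition that passes to the closure and hence to
    \<open>w\<close>.\<close>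
  have "closure (s_ball G x r) \<subseteq> {y. norm (x - y) \<le> r * (norm (z - x) + norm (z - y))}"
  proof (rule closure_minimal)
    show "s_ball G x r \<subseteq> {y. norm (x - y) \<le> r * (norm (z - x) + norm (z - y))}"
    proof clarify
      fix y assume "y \<in> s_ball G x r"
      then have "norm (x - y) / (norm (z - x) + norm (z - y)) < r"
        using triangular_ratio_ge[OF z(1), of x y] by (simp add: s_ball_def)
      then show "norm (x - y) \<le> r * (norm (z - x) + norm (z - y))"
        using zw(2) d by (simp add: pos_divide_less_eq add_pos_nonneg)
    qed
    show "closed {y. norm (x - y) \<le> r * (norm (z - x) + norm (z - y))}"
      by (intro closed_Collect_le continuous_intros)
  qed
  then have le: "norm (x - w) \<le> 2 * r * bdist G x" using cl zw by auto
  \<comment> \<open>Lower bound: the \<open>j\<close>-ball is open and contained in the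
    \<open>s\<close>-ball, so it lies in the interior and misses \<open>w\<close>.\<close>
  have "w \<notin> interior (s_ball G x r)" using w(1) by (simp add: frontier_def)
  then have "w \<notin> j_ball G x (ln (1 + 2 * r))"
    using interior_maximal[OF j_ball_subset_s_ball[OF assms(1-4)] open_j_ball[OF assms(1-3)]]
      assms(4) by auto
  then have ge: "2 * r * bdist G x \<le> norm (x - w)"
    using mem_j_ball_iff[OF assms(1-3), of "2 * r"] wG w(2) assms(4) by auto
  have "r = norm (x - w) / (norm (z - x) + norm (z - w))"
    using le ge zw d by simp
  also have "\<dots> \<le> triangular_ratio G x w" by (rule triangular_ratio_ge[OF z(1)])
  finally have "w \<notin> s_ball G x r" by (simp add: s_ball_def)
  then show ?thesis using sharp_inner_j_ballI[OF assms(1-3) wG] assms(4) w(2) le by simp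
qed

section \<open>The punctured space, whose boundary is a single point\<close>

lemma frontier_punctured:
  fixes a :: "'a::euclidean_space"
  shows "frontier (UNIV - {a}) = {a}"
  using frontier_complement[of "{a}"] by (simp add: Compl_eq_Diff_UNIV frontier_def)

text \<open>Connectedness needs dimension at least 2; a basis vector shows that the set is
  nonempty.\<close>

lemma is_domain_punctured:
  assumes "2 \<le> DIM('a)"
  shows "is_domain (UNIV - {0 :: 'a::euclidean_space})"
  using connected_punctured_universe[OF assms, of "0::'a"] SOME_Basis
    nonzero_Basis[OF SOME_Basis] unfolding is_domain_def
  by (auto simp: Compl_eq_Diff_UNIV open_delete)

lemma bdist_punctured: "bdist (UNIV - {0}) x = norm x"
  by (simp add: bdist_def frontier_punctured)

lemma triangular_ratio_punctured:
  "triangular_ratio (UNIV - {0}) x y = norm (x - y) / (norm x + norm y)"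
  by (simp add: triangular_ratio_def frontier_punctured)

lemma sharp_inner_ball_punctured:
  fixes x :: "'a::euclidean_space"
  assumes "x \<noteq> 0" "r \<in> {0<..<1}"
  shows "sharp_inner_radius (ball x) (2 * r / (1 + r) * norm x) (s_ball (UNIV - {0}) x r)"
  unfolding sharp_inner_radius_def
proof (intro allI impI)
  fix \<rho> assume \<rho>: "2 * r / (1 + r) * norm x < \<rho>"
  \<comment> \<open>The point of the segment from \<open>0\<close> to \<open>x\<close> where
    \<open>norm x - norm y = r * (norm x + norm y)\<close>, so that \<open>s\<close> equals
    \<open>r\<close> exactly.\<close>
  define y where "y = ((1 - r) / (1 + r)) *\<^sub>R x"
  have "x - y = (2 * r / (1 + r)) *\<^sub>R x"
    using assms(2) unfolding y_def scaleR_left_diff_distrib[symmetric, of 1, simplified]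
    by (simp add: field_simps)
  then have n: "norm (x - y) = 2 * r / (1 + r) * norm x" using assms(2) by simp
  have "norm x + norm y = 2 / (1 + r) * norm x"
    using assms(2) unfolding y_def by (simp add: field_simps)
  then have "norm (x - y) = r * (norm x + norm y)" using n by simp
  moreover have "norm x + norm y \<noteq> 0" using assms(1) by (simp add: add_nonneg_eq_0_iff)
  ultimately have "triangular_ratio (UNIV - {0}) x y = r"
    by (simp add: triangular_ratio_punctured)
  then show "\<not> ball x \<rho> \<subseteq> s_ball (UNIV - {0}) x r"
    using n \<rho> by (auto simp: s_ball_def dist_norm subset_iff intro!: exI[of _ y])
qed

text \<open>Moving outward along the ray gives \<open>s = c / (2 + c)\<close>, which reaches
  \<open>r\<close> at \<open>c = 2 * r / (1 - r)\<close>. Both outer sharpness results take their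
  witnesses here.\<close>

lemma ray_mem_s_ball_punctured:
  fixes x :: "'a::euclidean_space"
  assumes "x \<noteq> 0" "r \<in> {0<..<1}" "0 \<le> c" "c < 2 * r / (1 - r)"
  shows "(1 + c) *\<^sub>R x \<in> s_ball (UNIV - {0}) x r"
proof -
  have "x - (1 + c) *\<^sub>R x = (- c) *\<^sub>R x" by (simp add: algebra_simps)
  then have "norm (x - (1 + c) *\<^sub>R x) = c * norm x" using assms(3) by simp
  moreover have "norm x + norm ((1 + c) *\<^sub>R x) = (2 + c) * norm x"
    using assms(3) unfolding norm_scaleR by (simp add: distrib_right)
  ultimately have "triangular_ratio (UNIV - {0}) x ((1 + c) *\<^sub>R x) = c / (2 + c)"
    using assms(1) unfolding triangular_ratio_punctured by simp
  also have "\<dots> < r" using assms by (simp add: field_simps)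
  finally show ?thesis using assms(1,3) by (simp add: s_ball_def)
qed

lemma sharp_outer_ball_punctured:
  fixes x :: "'a::euclidean_space"
  assumes "x \<noteq> 0" "r \<in> {0<..<1}"
  shows "sharp_outer_radius (ball x) (2 * r / (1 - r) * norm x) (s_ball (UNIV - {0}) x r)"
  unfolding sharp_outer_radius_def
proof (intro allI impI)
  fix \<rho> assume \<rho>: "\<rho> < 2 * r / (1 - r) * norm x"
  \<comment> \<open>Places \<open>(1 + c) *\<^sub>R x\<close> at distance at least
    \<open>\<rho>\<close> from \<open>x\<close>; the maximum with \<open>0\<close> covers negative
    \<open>\<rho>\<close>.\<close>
  define c where "c = max 0 (\<rho> / norm x)"
  have "\<rho> / norm x < 2 * r / (1 - r)" using \<rho> assms(1) by (simp add: pos_divide_less_eq)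
  then have "c < 2 * r / (1 - r)" using assms(2) by (simp add: c_def)
  then have "(1 + c) *\<^sub>R x \<in> s_ball (UNIV - {0}) x r"
    using ray_mem_s_ball_punctured[OF assms] by (simp add: c_def)
  moreover have "\<rho> \<le> c * norm x"
    using assms(1) by (simp add: c_def pos_divide_le_eq[symmetric])
  then have "(1 + c) *\<^sub>R x \<notin> ball x \<rho>"
    by (simp add: dist_norm scaleR_left_distrib c_def)
  ultimately show "\<not> s_ball (UNIV - {0}) x r \<subseteq> ball x \<rho>" by blast
qed

lemma sharp_outer_j_ball_punctured:
  fixes x :: "'a::euclidean_space"
  assumes "x \<noteq> 0" "r \<in> {0<..<1}"
  shows "sharp_outer_radius (j_ball (UNIV - {0}) x) (ln (1 + 2 * r / (1 - r)))
    (s_ball (UNIV - {0}) x r)"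
  unfolding sharp_outer_radius_def
proof (intro allI impI)
  fix \<rho> assume \<rho>: "\<rho> < ln (1 + 2 * r / (1 - r))"
  \<comment> \<open>Solves \<open>ln (1 + c) = \<rho>\<close>; for negative \<open>\<rho>\<close>
    the witness is \<open>x\<close> itself.\<close>
  define c where "c = max 0 (exp \<rho> - 1)"
  have pos: "0 < 2 * r / (1 - r)" using assms(2) by simp
  then have "exp \<rho> < 1 + 2 * r / (1 - r)"
    using \<rho> by (metis add_pos_pos exp_less_cancel_iff exp_ln zero_less_one)
  then have "c < 2 * r / (1 - r)" using pos by (simp add: c_def)
  then have "(1 + c) *\<^sub>R x \<in> s_ball (UNIV - {0}) x r"
    using ray_mem_s_ball_punctured[OF assms] by (simp add: c_def)
  moreover have c: "0 \<le> c" "exp \<rho> \<le> 1 + c" by (simp_all add: c_def)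
  \<comment> \<open>The witness is no closer to \<open>0\<close> than \<open>x\<close>, so the
    minimum in \<open>j_metric\<close> is \<open>norm x\<close>.\<close>
  have "norm x \<le> norm ((1 + c) *\<^sub>R x)"
    using c unfolding norm_scaleR by (simp add: distrib_right)
  moreover have "norm (x - (1 + c) *\<^sub>R x) = c * norm x"
    using c by (simp add: scaleR_left_distrib)
  ultimately have "j_metric (UNIV - {0}) x ((1 + c) *\<^sub>R x) = ln (1 + c)"
    using assms(1) by (simp add: j_metric_def bdist_punctured min_absorb1)
  then have "(1 + c) *\<^sub>R x \<notin> j_ball (UNIV - {0}) x \<rho>"
    using c by (simp add: j_ball_def not_less ln_ge_iff)
  with \<open>(1 + c) *\<^sub>R x \<in> s_ball (UNIV - {0}) x r\<close>
  show "\<not> s_ball (UNIV - {0}) x r \<subseteq> j_ball (UNIV - {0}) x \<rho>" by blast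
qed

text \<open>Intermediate values on the sphere, connected in dimension at least 2: the distance from
  \<open>x\<close> is \<open>0\<close> at \<open>x\<close> and \<open>2 * norm x\<close> at
  \<open>- x\<close>.\<close>

lemma exists_sphere_point_at_dist:
  fixes x :: "'a::euclidean_space"
  assumes "2 \<le> DIM('a)" "0 \<le> t" "t \<le> 2 * norm x"
  obtains y where "norm y = norm x" "norm (x - y) = t"
proof -
  have "connected ((\<lambda>y. norm (x - y)) ` sphere 0 (norm x))"
    using assms(1) by (intro connected_continuous_image connected_sphere continuous_intros)
  moreover have "0 \<in> (\<lambda>y. norm (x - y)) ` sphere 0 (norm x)"
    by (intro image_eqI[of _ _ x]) auto
  moreover have "2 * norm x \<in> (\<lambda>y. norm (x - y)) ` sphere 0 (norm x)"
    by (intro image_eqI[of _ _ "- x"]) (auto simp: scaleR_2[symmetric])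
  ultimately have "t \<in> (\<lambda>y. norm (x - y)) ` sphere 0 (norm x)"
    using assms(2,3) by (meson connectedD_interval)
  then show thesis using that by auto
qed

lemma sharp_inner_j_ball_punctured:
  fixes x :: "'a::euclidean_space"
  assumes "2 \<le> DIM('a)" "x \<noteq> 0" "r \<in> {0<..<1}"
  shows "sharp_inner_radius (j_ball (UNIV - {0}) x) (ln (1 + 2 * r)) (s_ball (UNIV - {0}) x r)"
proof -
  \<comment> \<open>Equal norms make both boundary distances agree, so this distance gives
    \<open>s = r\<close> and \<open>j = ln (1 + 2 * r)\<close> at once.\<close>
  obtain w where w: "norm w = norm x" "norm (x - w) = 2 * r * norm x"
    using exists_sphere_point_at_dist[OF assms(1), of "2 * r * norm x" x] assms(3)
    by (auto simp: mult_left_le_one_le)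
  have "triangular_ratio (UNIV - {0}) x w = r"
    using w assms(2) by (simp add: triangular_ratio_punctured)
  then show ?thesis
    using w assms by (intro sharp_inner_j_ballI[of _ _ w] is_domain_punctured)
      (auto simp: s_ball_def bdist_punctured)
qed

theorem theorem1p3:
  assumes "CARD('n::finite) \<ge> 2"
  shows
    "(\<forall>G::(real ^ 'n) set. is_domain G \<and> G \<noteq> UNIV \<longrightarrow>
       (\<forall>x\<in>G. \<forall>r\<in>{0<..<1}.
          ball x (2 * r / (1 + r) * bdist G x) \<subseteq> s_ball G x r \<and>
          s_ball G x r \<subseteq> ball x (2 * r / (1 - r) * bdist G x)))
     \<and>
     (\<forall>G::(real ^ 'n) set. is_domain G \<and> G \<noteq> UNIV \<longrightarrow>
       (\<forall>x\<in>G. \<forall>r\<in>{0<..<1}.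
          j_ball G x (ln (1 + 2 * r)) \<subseteq> s_ball G x r \<and>
          ((\<exists>w\<in>frontier (s_ball G x r). bdist G x = bdist G w \<and>
               frontier G \<inter> sphere w (bdist G w) \<inter> sphere x (bdist G x) \<noteq> {}) \<longrightarrow>
             sharp_inner_radius (j_ball G x) (ln (1 + 2 * r)) (s_ball G x r))) \<and>
       (\<forall>x\<in>G. \<forall>r\<in>{0<..<1/3}.
          s_ball G x r \<subseteq> j_ball G x (ln (1 + 2 * r / (1 - 3 * r)))))
     \<and>
     (\<forall>G::(real ^ 'n) set. G = UNIV - {0} \<longrightarrow>
       (\<forall>x\<in>G. \<forall>r\<in>{0<..<1}.
          ball x (2 * r / (1 + r) * norm x) \<subseteq> s_ball G x r \<and>
          s_ball G x r \<subseteq> ball x (2 * r / (1 - r) * norm x) \<and>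
          sharp_inner_radius (ball x) (2 * r / (1 + r) * norm x) (s_ball G x r) \<and>
          sharp_outer_radius (ball x) (2 * r / (1 - r) * norm x) (s_ball G x r)))
     \<and>
     (\<forall>G::(real ^ 'n) set. G = UNIV - {0} \<longrightarrow>
       (\<forall>x\<in>G. \<forall>r\<in>{0<..<1}.
          j_ball G x (ln (1 + 2 * r)) \<subseteq> s_ball G x r \<and>
          s_ball G x r \<subseteq> j_ball G x (ln (1 + 2 * r / (1 - r))) \<and>
          sharp_inner_radius (j_ball G x) (ln (1 + 2 * r)) (s_ball G x r) \<and>
          sharp_outer_radius (j_ball G x) (ln (1 + 2 * r / (1 - r))) (s_ball G x r)))"
proof -
  have dim: "2 \<le> DIM(real ^ 'n)" using assms by simp
  let ?P = "UNIV - {0 :: real ^ 'n}"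
  have P: "is_domain ?P" "?P \<noteq> UNIV" using is_domain_punctured[OF dim] by auto
  show ?thesis
  proof (intro conjI allI impI ballI; (elim conjE bexE)?)
    fix G :: "(real ^ 'n) set" and x r
    assume G: "is_domain G" "G \<noteq> UNIV" "x \<in> G" and r: "r \<in> {0<..<1::real}"
    show "ball x (2 * r / (1 + r) * bdist G x) \<subseteq> s_ball G x r"
      by (rule ball_subset_s_ball[OF G r])
    show "s_ball G x r \<subseteq> ball x (2 * r / (1 - r) * bdist G x)"
      by (rule s_ball_subset_ball[OF G r])
    show "j_ball G x (ln (1 + 2 * r)) \<subseteq> s_ball G x r"
      using j_ball_subset_s_ball[OF G] r by simp
    fix w
    assume "w \<in> frontier (s_ball G x r)" "bdist G x = bdist G w"
      "frontier G \<inter> sphere w (bdist G w) \<inter> sphere x (bdist G x) \<noteq> {}"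
    then show "sharp_inner_radius (j_ball G x) (ln (1 + 2 * r)) (s_ball G x r)"
      using sharp_inner_j_ball_if_frontier[OF G] r by fastforce
  next
    fix G :: "(real ^ 'n) set" and x r
    assume G: "is_domain G" "G \<noteq> UNIV" "x \<in> G" and r: "r \<in> {0<..<1/3::real}"
    \<comment> \<open>For \<open>r < 1/3\<close> both denominators are positive and
      \<open>1 - 3 * r\<close> is the smaller one.\<close>
    have "2 * r / (1 - r) \<le> 2 * r / (1 - 3 * r)"
      using r by (intro divide_left_mono mult_pos_pos) auto
    then show "s_ball G x r \<subseteq> j_ball G x (ln (1 + 2 * r / (1 - 3 * r)))"
      using s_ball_subset_j_ball[OF G] r by simp
  next
    fix G :: "(real ^ 'n) set" and x r
    assume G: "G = ?P" "x \<in> G" and r: "r \<in> {0<..<1::real}"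
    then have x: "x \<in> ?P" "x \<noteq> 0" by auto
    show "ball x (2 * r / (1 + r) * norm x) \<subseteq> s_ball G x r"
      using ball_subset_s_ball[OF P x(1) r] by (simp add: G(1) bdist_punctured)
    show "s_ball G x r \<subseteq> ball x (2 * r / (1 - r) * norm x)"
      using s_ball_subset_ball[OF P x(1) r] by (simp add: G(1) bdist_punctured)
    show "sharp_inner_radius (ball x) (2 * r / (1 + r) * norm x) (s_ball G x r)"
      using sharp_inner_ball_punctured[OF x(2) r] by (simp add: G(1))
    show "sharp_outer_radius (ball x) (2 * r / (1 - r) * norm x) (s_ball G x r)"
      using sharp_outer_ball_punctured[OF x(2) r] by (simp add: G(1))
    show "j_ball G x (ln (1 + 2 * r)) \<subseteq> s_ball G x r"
      using j_ball_subset_s_ball[OF P x(1)] r by (simp add: G(1))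
    show "s_ball G x r \<subseteq> j_ball G x (ln (1 + 2 * r / (1 - r)))"
      using s_ball_subset_j_ball[OF P x(1) r] by (simp add: G(1))
    show "sharp_inner_radius (j_ball G x) (ln (1 + 2 * r)) (s_ball G x r)"
      using sharp_inner_j_ball_punctured[OF dim x(2) r] by (simp add: G(1))
    show "sharp_outer_radius (j_ball G x) (ln (1 + 2 * r / (1 - r))) (s_ball G x r)"
      using sharp_outer_j_ball_punctured[OF x(2) r] by (simp add: G(1))
  qed
qed

end
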